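(* (Parallel transport) Let $(\mathbb X,\mathbb T)$ be a Cartesian tangent category with a curve object $(C,c_0,c_1)$. Let $(R,H)$ be an Ehresmann connection on a tangent display map $q\colon E\to M$, let $\gamma\colon C\to M$ be a morphism, let $e_0\colon *\to E$ be a morphism with $e_0q=c_0\gamma$, and suppose that a (necessarily unique) solution to the dynamical system $(\gamma^*(E),\langle c_0,e_0\rangle,\gamma_H)$ exists. Then there exists a unique morphism $\hat\gamma\colon C\to E$ such that: (i) $c_0\hat\gamma=e_0$; (ii) $\hat\gamma q=\gamma$; (iii) $c_1\,T\hat\gamma\,R=\hat\gamma\,z_q^V$.
   Context: Composition is diagrammatic: $fg$ is $f$ followed by $g$; $\langle f,g\rangle$ denotes pairing into a (fibred) product, with projections $\pi_1,\pi_2$. A tangent category $(\mathbb X,\mathbb T)$ is a category $\mathbb X$ with an endofunctor $T$ and natural transformations $p_M\colon TM\to M$, $z_M\colon M\to TM$, $s_M\colon T_2M\to TM$, $l_M\colon TM\to T^2M$, $c_M\colon T^2M\to T^2M$, where the $n$-fold pullback $T_nM$ of $p_M$ along itself exists and is preserved by all $T^m$, such that: $(p_M,z_M,s_M)$ is an additive bundle (a commutative monoid in the category over $M$); $(z_M,l_M)\colon p_M\to Tp_M$ and $(\mathrm{id}_{TM},c_M)\colon Tp_M\to p_{TM}$ are additive bundle morphisms (commutative squares preserving zero and sum); $c_Mc_M=\mathrm{id}$, $l_Mc_M=l_M$, $l_M\,Tl_M=l_M\,l_{TM}$, $Tc_M\,c_{TM}\,Tc_M=c_{TM}\,Tc_M\,c_{TM}$,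 $l_{TM}\,Tc_M\,c_{TM}=c_M\,Tl_M$; and, with $\xi_M=\langle\pi_1l_M,\pi_2z_{TM}\rangle\,Ts_M\colon T_2M\to T^2M$, the square $\xi_M\,Tp_M=\pi_1p_Mz_M$ is a tangent pullback. A tangent pullback is a pullback preserved by $T^m$ for all $m\ge0$. It is Cartesian if $\mathbb X$ has finite products (terminal object $*$, unique maps $!$) preserved by $T$. A tangent display map is a morphism $q\colon E\to M$ such that for all $n\ge0$ and all $f\colon N\to T^nM$ the pullback of $T^nq$ along $f$ exists and is a tangent pullback. Convention: differential bundles (in the sense of Cockett–Cruttwell) are assumed to have tangent display projections; in particular every $p_M$ is a tangent display map. For a tangent display map $q\colon E\to M$: $Vq$ is the tangent pullback of $Tq$ along $z_M$, with projections $\iota_q\colon Vq\to TE$ and $T^Vq\colon Vq\to M$; $q^V=\iota_qp_E\colon Vq\to E$; $z_q^V\colon E\to Vq$ and $l_q^V\colon Vq\to TVq$ are determined by $z_q^V\iota_q=z_E$, $l_q^V\,T\iota_q=\iota_ql_E$. $Fq$ is the tangent pullback of $q$ along $p_M$, with projections $q^F\colon Fq\to E$, $T^Fq\colon Fq\to TM$, and $l_q^F\colon Fq\to TFq$ is determined by $l_q^F\,Tq^F=q^Fz_E$, $l_q^F\,T(T^Fq)=T^Fq\,l_M$. $\pi_q\colon TE\to Fq$ is the unique morphism with $\pi_qq^F=p_E$, $\pi_q\,T^Fq=Tq$. An Ehresmann connection on $q$ is a pair of $R\colon TE\to Vq$ with $\iota_qR=\mathrm{id}_{Vq}$, $Rq^V=p_E$,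 $Rl_q^V=l_E\,TR$ (a vertical connection) and $H\colon Fq\to TE$ with $H\pi_q=\mathrm{id}_{Fq}$, $Hp_E=q^F$, $Hl_E=l_q^F\,TH$ (a horizontal connection), such that $HR=q^Fz_q^V$ and $\langle R\iota_q,\pi_qH\rangle s_E=\mathrm{id}_{TE}$. A vector field on $M$ is $X\colon M\to TM$ with $Xp_M=\mathrm{id}_M$. A dynamical system $(M,s,X)$ on $M$ is a morphism $s\colon N\to M$ with a vector field $X$ on $M$. A curve object in a Cartesian tangent category is a dynamical system $(C,c_0,c_1)$ with $c_0\colon *\to C$ such that: (CO.1) for every dynamical system $(M,s\colon N\to M,X)$ there is at most one $\gamma\colon C\times N\to M$ with $\langle{!}c_0,\mathrm{id}_N\rangle\gamma=s$ and $(c_1\times z_N)\,T\gamma=\gamma X$ (such a $\gamma$, when it exists, is called a solution of the system); (CO.2) $c_1\,Tc_1\,c_C=c_1\,Tc_1$, where $c_C$ is the canonical flip at $C$; (CO.3) the system $(C,c_0,c_1)$ has as initial condition $\mathrm{id}$-parametrised flow, i.e. it has a solution when its initial condition and vector field are those prescribed by the curve object: the system $(C,c_0,c_1)$ has a solution. Given a horizontal connection $H$ on $q$ and $\gamma\colon C\to M$, $\gamma^*(E)$ is the pullback of $q$ along $\gamma$, with projections $\pi_0\colon\gamma^*(E)\to C$, $\pi_1\colon\gamma^*(E)\to E$; it is a tangent pullback, and $\gamma_H\colon\gamma^*(E)\to T(\gamma^*(E))$ is the vector field $\gamma_H=\langle\pi_0c_1,\langle\pi_0c_1\,T\gamma,\pi_1\rangle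 H\rangle$, where $\langle\pi_0c_1\,T\gamma,\pi_1\rangle\colon\gamma^*(E)\to Fq$ is the morphism with $T^Fq$-component $\pi_0c_1\,T\gamma$ and $q^F$-component $\pi_1$. *)

theory Defs
  imports Main
begin

section \<open>Categories, pullbacks and pairings\<close>

text \<open>Composition is diagrammatic: \<open>f \<cdot> g\<close> is \<open>f\<close> followed by \<open>g\<close>.\<close>

record ('o, 'm) cat_data =
  Obj :: "'o set"
  Arr :: "'m set"
  Dom :: "'m \<Rightarrow> 'o"
  Cod :: "'m \<Rightarrow> 'o"
  idt :: "'o \<Rightarrow> 'm"
  cmp :: "'m \<Rightarrow> 'm \<Rightarrow> 'm" (infixl "\<cdot>\<index>" 70)

definition Hom :: "('o, 'm, 'z) cat_data_scheme \<Rightarrow> 'o \<Rightarrow> 'o \<Rightarrow> 'm set" where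
  "Hom X A B = {f \<in> Arr X. Dom X f = A \<and> Cod X f = B}"

locale category =
  fixes X :: "('o, 'm, 'z) cat_data_scheme" (structure)
  assumes Dom_in: "f \<in> Arr X \<Longrightarrow> Dom X f \<in> Obj X"
    and Cod_in: "f \<in> Arr X \<Longrightarrow> Cod X f \<in> Obj X"
    and idt_in: "A \<in> Obj X \<Longrightarrow> idt X A \<in> Hom X A A"
    and cmp_in: "f \<in> Hom X A B \<Longrightarrow> g \<in> Hom X B D \<Longrightarrow> f \<cdot> g \<in> Hom X A D"
    and idt_cmp: "f \<in> Hom X A B \<Longrightarrow> idt X A \<cdot> f = f"
    and cmp_idt: "f \<in> Hom X A B \<Longrightarrow> f \<cdot> idt X B = f"
    and cmp_assoc: "f \<in> Hom X A B \<Longrightarrow> g \<in> Hom X B D \<Longrightarrow> h \<in> Hom X D K \<Longrightarrow>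
      (f \<cdot> g) \<cdot> h = f \<cdot> (g \<cdot> h)"

text \<open>\<open>is_pullback X f g P a b\<close>: the object \<open>P\<close> with projections \<open>a\<close> and \<open>b\<close> is a pullback
  of \<open>f\<close> along \<open>g\<close>, where \<open>a \<cdot> f = b \<cdot> g\<close>.\<close>

definition is_pullback ::
  "('o, 'm, 'z) cat_data_scheme \<Rightarrow> 'm \<Rightarrow> 'm \<Rightarrow> 'o \<Rightarrow> 'm \<Rightarrow> 'm \<Rightarrow> bool" where
  "is_pullback X f g P a b \<longleftrightarrow>
     f \<in> Arr X \<and> g \<in> Arr X \<and> Cod X f = Cod X g \<and>
     a \<in> Hom X P (Dom X f) \<and> b \<in> Hom X P (Dom X g) \<and> a \<cdot> f = b \<cdot> g \<and>
     (\<forall>Y \<in> Obj X. \<forall>x \<in> Hom X Y (Dom X f). \<forall>y \<in> Hom X Y (Dom X g). x \<cdot> f = y \<cdot> g \<longrightarrow>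
        (\<exists>!u. u \<in> Hom X Y P \<and> u \<cdot> a = x \<and> u \<cdot> b = y))" for X (structure)

text \<open>The \<open>n\<close>-fold pullback of \<open>q\<close> along itself: \<open>r\<close> is the common composite of the
  projections \<open>a 0, \<dots>, a (n - 1)\<close> with \<open>q\<close>. For \<open>n = 0\<close> this makes \<open>r\<close> an isomorphism.\<close>

definition is_fibre_power ::
  "('o, 'm, 'z) cat_data_scheme \<Rightarrow> 'm \<Rightarrow> nat \<Rightarrow> 'o \<Rightarrow> 'm \<Rightarrow> (nat \<Rightarrow> 'm) \<Rightarrow> bool" where
  "is_fibre_power X q n P r a \<longleftrightarrow>
     q \<in> Arr X \<and> r \<in> Hom X P (Cod X q) \<and>
     (\<forall>i < n. a i \<in> Hom X P (Dom X q) \<and> a i \<cdot> q = r) \<and>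
     (\<forall>Y \<in> Obj X. \<forall>v \<in> Hom X Y (Cod X q). \<forall>x.
        (\<forall>i < n. x i \<in> Hom X Y (Dom X q) \<and> x i \<cdot> q = v) \<longrightarrow>
        (\<exists>!u. u \<in> Hom X Y P \<and> u \<cdot> r = v \<and> (\<forall>i < n. u \<cdot> a i = x i)))" for X (structure)

text \<open>The pairing \<open>\<langle>x, y\<rangle>\<close> into a pullback or product with projections \<open>a\<close> and \<open>b\<close>.\<close>

definition pair :: "('o, 'm, 'z) cat_data_scheme \<Rightarrow> 'm \<Rightarrow> 'm \<Rightarrow> 'm \<Rightarrow> 'm \<Rightarrow> 'm" where
  "pair X a b x y =
     (THE u. u \<in> Hom X (Dom X x) (Dom X a) \<and> u \<cdot> a = x \<and> u \<cdot> b = y)" for X (structure)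

definition is_terminal :: "('o, 'm, 'z) cat_data_scheme \<Rightarrow> 'o \<Rightarrow> bool" where
  "is_terminal X K \<longleftrightarrow> K \<in> Obj X \<and> (\<forall>A \<in> Obj X. \<exists>!f. f \<in> Hom X A K)"

definition is_product ::
  "('o, 'm, 'z) cat_data_scheme \<Rightarrow> 'o \<Rightarrow> 'o \<Rightarrow> 'o \<Rightarrow> 'm \<Rightarrow> 'm \<Rightarrow> bool" where
  "is_product X A B P a b \<longleftrightarrow>
     a \<in> Hom X P A \<and> b \<in> Hom X P B \<and>
     (\<forall>Y \<in> Obj X. \<forall>x \<in> Hom X Y A. \<forall>y \<in> Hom X Y B.
        \<exists>!u. u \<in> Hom X Y P \<and> u \<cdot> a = x \<and> u \<cdot> b = y)" for X (structure)


section \<open>Additive bundles\<close>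

text \<open>A chosen fibre product of \<open>bproj\<close> with itself is part of the data; it is the domain
  of the addition \<open>bplus\<close>.\<close>

record ('o, 'm) bundle_data =
  bproj :: 'm
  bprod :: 'o
  bfst :: 'm
  bsnd :: 'm
  bzero :: 'm
  bplus :: 'm

definition bsum :: "('o, 'm, 'z) cat_data_scheme \<Rightarrow> ('o, 'm) bundle_data \<Rightarrow> 'm \<Rightarrow> 'm \<Rightarrow> 'm" where
  "bsum X B x y = pair X (bfst B) (bsnd B) x y \<cdot> bplus B" for X (structure)

text \<open>A commutative monoid in the category over the base; the monoid laws are stated
  on generalised elements \<open>x, y, w\<close> over the base, with arbitrary domain \<open>Y\<close>.\<close>

definition additive_bundle ::
  "('o, 'm, 'z) cat_data_scheme \<Rightarrow> ('o, 'm) bundle_data \<Rightarrow> bool" where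
  "additive_bundle X B \<longleftrightarrow>
     (let q = bproj B; E = Dom X q; M = Cod X q in
       is_pullback X q q (bprod B) (bfst B) (bsnd B) \<and>
       bzero B \<in> Hom X M E \<and> bzero B \<cdot> q = idt X M \<and>
       bplus B \<in> Hom X (bprod B) E \<and> bplus B \<cdot> q = bfst B \<cdot> q \<and>
       (\<forall>Y \<in> Obj X. \<forall>x \<in> Hom X Y E. bsum X B x (x \<cdot> q \<cdot> bzero B) = x) \<and>
       (\<forall>Y \<in> Obj X. \<forall>x \<in> Hom X Y E. \<forall>y \<in> Hom X Y E. x \<cdot> q = y \<cdot> q \<longrightarrow>
          bsum X B x y = bsum X B y x) \<and>
       (\<forall>Y \<in> Obj X. \<forall>x \<in> Hom X Y E. \<forall>y \<in> Hom X Y E. \<forall>w \<in> Hom X Y E.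
          x \<cdot> q = y \<cdot> q \<longrightarrow> y \<cdot> q = w \<cdot> q \<longrightarrow>
          bsum X B (bsum X B x y) w = bsum X B x (bsum X B y w)))" for X (structure)

definition additive_bundle_morphism ::
  "('o, 'm, 'z) cat_data_scheme \<Rightarrow> ('o, 'm) bundle_data \<Rightarrow> ('o, 'm) bundle_data \<Rightarrow>
   'm \<Rightarrow> 'm \<Rightarrow> bool" where
  "additive_bundle_morphism X B B' f g \<longleftrightarrow>
     f \<in> Hom X (Cod X (bproj B)) (Cod X (bproj B')) \<and>
     g \<in> Hom X (Dom X (bproj B)) (Dom X (bproj B')) \<and>
     g \<cdot> bproj B' = bproj B \<cdot> f \<and>
     bzero B \<cdot> g = f \<cdot> bzero B' \<and>
     bplus B \<cdot> g = bsum X B' (bfst B \<cdot> g) (bsnd B \<cdot> g)" for X (structure)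


section \<open>Tangent categories\<close>

text \<open>\<open>(T2 X M, fst2 X M, snd2 X M)\<close> is a chosen pullback of the projection \<open>p\<close> with itself,
  the domain of the addition; the other fibre powers of \<open>p\<close> are only required to exist.\<close>

record ('o, 'm) tangent_data = "('o, 'm) cat_data" +
  Tob :: "'o \<Rightarrow> 'o"
  Tar :: "'m \<Rightarrow> 'm"
  T2 :: "'o \<Rightarrow> 'o"
  fst2 :: "'o \<Rightarrow> 'm"
  snd2 :: "'o \<Rightarrow> 'm"
  tproj :: "'o \<Rightarrow> 'm"
  tzero :: "'o \<Rightarrow> 'm"
  tplus :: "'o \<Rightarrow> 'm"
  tlift :: "'o \<Rightarrow> 'm"
  tflip :: "'o \<Rightarrow> 'm"

definition tangent_pullback ::
  "('o, 'm, 'z) tangent_data_scheme \<Rightarrow> 'm \<Rightarrow> 'm \<Rightarrow> 'o \<Rightarrow> 'm \<Rightarrow> 'm \<Rightarrow> bool" where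
  "tangent_pullback X f g P a b \<longleftrightarrow>
     (\<forall>m. is_pullback X ((Tar X ^^ m) f) ((Tar X ^^ m) g) ((Tob X ^^ m) P)
            ((Tar X ^^ m) a) ((Tar X ^^ m) b))"

definition tangent_fibre_power ::
  "('o, 'm, 'z) tangent_data_scheme \<Rightarrow> 'm \<Rightarrow> nat \<Rightarrow> 'o \<Rightarrow> 'm \<Rightarrow> (nat \<Rightarrow> 'm) \<Rightarrow> bool" where
  "tangent_fibre_power X q n P r a \<longleftrightarrow>
     (\<forall>m. is_fibre_power X ((Tar X ^^ m) q) n ((Tob X ^^ m) P)
            ((Tar X ^^ m) r) (\<lambda>i. (Tar X ^^ m) (a i)))"

definition tangent_display_map :: "('o, 'm, 'z) tangent_data_scheme \<Rightarrow> 'm \<Rightarrow> bool" where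
  "tangent_display_map X q \<longleftrightarrow>
     q \<in> Arr X \<and>
     (\<forall>n. \<forall>N \<in> Obj X. \<forall>f \<in> Hom X N ((Tob X ^^ n) (Cod X q)).
        \<exists>P a b. tangent_pullback X f ((Tar X ^^ n) q) P a b)"

text \<open>The bundles \<open>p\<^sub>M\<close> and \<open>T p\<^sub>M\<close> with their additive structures. The fibre product
  of \<open>T p\<^sub>M\<close> with itself is \<open>T (T\<^sub>2 M)\<close>.\<close>

definition tbundle :: "('o, 'm, 'z) tangent_data_scheme \<Rightarrow> 'o \<Rightarrow> ('o, 'm) bundle_data" where
  "tbundle X M = \<lparr>bproj = tproj X M, bprod = T2 X M, bfst = fst2 X M, bsnd = snd2 X M,
     bzero = tzero X M, bplus = tplus X M\<rparr>"

definition Tbundle :: "('o, 'm, 'z) tangent_data_scheme \<Rightarrow> 'o \<Rightarrow> ('o, 'm) bundle_data" where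
  "Tbundle X M = \<lparr>bproj = Tar X (tproj X M), bprod = Tob X (T2 X M),
     bfst = Tar X (fst2 X M), bsnd = Tar X (snd2 X M),
     bzero = Tar X (tzero X M), bplus = Tar X (tplus X M)\<rparr>"

definition T2ar :: "('o, 'm, 'z) tangent_data_scheme \<Rightarrow> 'm \<Rightarrow> 'm" where
  "T2ar X f = (let M = Dom X f; N = Cod X f in
     pair X (fst2 X N) (snd2 X N) (fst2 X M \<cdot> Tar X f) (snd2 X M \<cdot> Tar X f))" for X (structure)

text \<open>\<open>\<xi>\<^sub>M = \<langle>\<pi>\<^sub>1 l\<^sub>M, \<pi>\<^sub>2 z\<^bsub>TM\<^esub>\<rangle> T s\<^sub>M\<close>\<close>

definition txi :: "('o, 'm, 'z) tangent_data_scheme \<Rightarrow> 'o \<Rightarrow> 'm" where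
  "txi X M =
     pair X (Tar X (fst2 X M)) (Tar X (snd2 X M))
       (fst2 X M \<cdot> tlift X M) (snd2 X M \<cdot> tzero X (Tob X M)) \<cdot> Tar X (tplus X M)"
  for X (structure)

text \<open>The assumption \<open>tproj_display\<close> is the trace, on the structure maps, of the convention that
  differential bundles have tangent display projections.\<close>

locale tangent_category = category X
  for X :: "('o, 'm, 'z) tangent_data_scheme" (structure) +
  assumes Tob_in: "M \<in> Obj X \<Longrightarrow> Tob X M \<in> Obj X"
    and Tar_in: "f \<in> Hom X M N \<Longrightarrow> Tar X f \<in> Hom X (Tob X M) (Tob X N)"
    and Tar_idt: "M \<in> Obj X \<Longrightarrow> Tar X (idt X M) = idt X (Tob X M)"
    and Tar_cmp: "f \<in> Hom X M N \<Longrightarrow> g \<in> Hom X N K \<Longrightarrow> Tar X (f \<cdot> g) = Tar X f \<cdot> Tar X g"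
    and tproj_in: "M \<in> Obj X \<Longrightarrow> tproj X M \<in> Hom X (Tob X M) M"
    and tzero_in: "M \<in> Obj X \<Longrightarrow> tzero X M \<in> Hom X M (Tob X M)"
    and tplus_in: "M \<in> Obj X \<Longrightarrow> tplus X M \<in> Hom X (T2 X M) (Tob X M)"
    and tlift_in: "M \<in> Obj X \<Longrightarrow> tlift X M \<in> Hom X (Tob X M) (Tob X (Tob X M))"
    and tflip_in: "M \<in> Obj X \<Longrightarrow> tflip X M \<in> Hom X (Tob X (Tob X M)) (Tob X (Tob X M))"
    and T2_pullback: "M \<in> Obj X \<Longrightarrow>
      tangent_pullback X (tproj X M) (tproj X M) (T2 X M) (fst2 X M) (snd2 X M)"
    and tproj_fibre_powers: "M \<in> Obj X \<Longrightarrow> \<exists>P r a. tangent_fibre_power X (tproj X M) n P r a"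
    and tproj_natural: "f \<in> Hom X M N \<Longrightarrow> Tar X f \<cdot> tproj X N = tproj X M \<cdot> f"
    and tzero_natural: "f \<in> Hom X M N \<Longrightarrow> f \<cdot> tzero X N = tzero X M \<cdot> Tar X f"
    and tplus_natural: "f \<in> Hom X M N \<Longrightarrow> T2ar X f \<cdot> tplus X N = tplus X M \<cdot> Tar X f"
    and tlift_natural: "f \<in> Hom X M N \<Longrightarrow>
      Tar X f \<cdot> tlift X N = tlift X M \<cdot> Tar X (Tar X f)"
    and tflip_natural: "f \<in> Hom X M N \<Longrightarrow>
      Tar X (Tar X f) \<cdot> tflip X N = tflip X M \<cdot> Tar X (Tar X f)"
    and tbundle_additive: "M \<in> Obj X \<Longrightarrow> additive_bundle X (tbundle X M)"
    and tlift_additive: "M \<in> Obj X \<Longrightarrow>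
      additive_bundle_morphism X (tbundle X M) (Tbundle X M) (tzero X M) (tlift X M)"
    and tflip_additive: "M \<in> Obj X \<Longrightarrow>
      additive_bundle_morphism X (Tbundle X M) (tbundle X (Tob X M))
        (idt X (Tob X M)) (tflip X M)"
    and tflip_tflip: "M \<in> Obj X \<Longrightarrow> tflip X M \<cdot> tflip X M = idt X (Tob X (Tob X M))"
    and tlift_tflip: "M \<in> Obj X \<Longrightarrow> tlift X M \<cdot> tflip X M = tlift X M"
    and tlift_tlift: "M \<in> Obj X \<Longrightarrow>
      tlift X M \<cdot> Tar X (tlift X M) = tlift X M \<cdot> tlift X (Tob X M)"
    and tflip_braid: "M \<in> Obj X \<Longrightarrow>
      Tar X (tflip X M) \<cdot> tflip X (Tob X M) \<cdot> Tar X (tflip X M) =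
      tflip X (Tob X M) \<cdot> Tar X (tflip X M) \<cdot> tflip X (Tob X M)"
    and tlift_tflip_braid: "M \<in> Obj X \<Longrightarrow>
      tlift X (Tob X M) \<cdot> Tar X (tflip X M) \<cdot> tflip X (Tob X M) =
      tflip X M \<cdot> Tar X (tlift X M)"
    and tlift_universal: "M \<in> Obj X \<Longrightarrow>
      tangent_pullback X (Tar X (tproj X M)) (tzero X M) (T2 X M)
        (txi X M) (fst2 X M \<cdot> tproj X M)"
    and tproj_display: "M \<in> Obj X \<Longrightarrow> tangent_display_map X (tproj X M)"

record ('o, 'm) cartesian_tangent_data = "('o, 'm) tangent_data" +
  one :: 'o ("\<^bold>1\<index>")
  prd :: "'o \<Rightarrow> 'o \<Rightarrow> 'o" (infixr "\<otimes>\<index>" 70)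
  pr1 :: "'o \<Rightarrow> 'o \<Rightarrow> 'm"
  pr2 :: "'o \<Rightarrow> 'o \<Rightarrow> 'm"

locale cartesian_tangent_category = tangent_category X
  for X :: "('o, 'm, 'z) cartesian_tangent_data_scheme" (structure) +
  assumes one_terminal: "is_terminal X \<^bold>1"
    and prd_product: "A \<in> Obj X \<Longrightarrow> B \<in> Obj X \<Longrightarrow>
      is_product X A B (A \<otimes> B) (pr1 X A B) (pr2 X A B)"
    and Tob_one_terminal: "is_terminal X (Tob X \<^bold>1)"
    and Tob_prd_product: "A \<in> Obj X \<Longrightarrow> B \<in> Obj X \<Longrightarrow>
      is_product X (Tob X A) (Tob X B) (Tob X (A \<otimes> B)) (Tar X (pr1 X A B)) (Tar X (pr2 X A B))"

definition bang :: "('o, 'm, 'z) cartesian_tangent_data_scheme \<Rightarrow> 'o \<Rightarrow> 'm" where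
  "bang X A = (THE f. f \<in> Hom X A \<^bold>1)" for X (structure)


section \<open>Vector fields, dynamical systems and curve objects\<close>

definition vector_field :: "('o, 'm, 'z) tangent_data_scheme \<Rightarrow> 'o \<Rightarrow> 'm \<Rightarrow> bool" where
  "vector_field X M v \<longleftrightarrow> v \<in> Hom X M (Tob X M) \<and> v \<cdot> tproj X M = idt X M" for X (structure)

definition dynamical_system ::
  "('o, 'm, 'z) tangent_data_scheme \<Rightarrow> 'o \<Rightarrow> 'o \<Rightarrow> 'm \<Rightarrow> 'm \<Rightarrow> bool" where
  "dynamical_system X N M s v \<longleftrightarrow>
     N \<in> Obj X \<and> M \<in> Obj X \<and> s \<in> Hom X N M \<and> vector_field X M v"

text \<open>\<open>solution X C c0 c1 N M s v g\<close>: the morphism \<open>g : C \<times> N \<rightarrow> M\<close> solves the system \<open>(M, s, v)\<close>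
  with \<open>s : N \<rightarrow> M\<close>. Since \<open>T\<close> preserves products, \<open>c1 \<times> z\<^sub>N\<close> is taken with codomain
  \<open>T (C \<times> N)\<close>, i.e. it is paired against the projections \<open>T \<pi>\<^sub>1\<close> and \<open>T \<pi>\<^sub>2\<close>.\<close>

definition solution ::
  "('o, 'm, 'z) cartesian_tangent_data_scheme \<Rightarrow> 'o \<Rightarrow> 'm \<Rightarrow> 'm \<Rightarrow> 'o \<Rightarrow> 'o \<Rightarrow> 'm \<Rightarrow> 'm \<Rightarrow>
   'm \<Rightarrow> bool" where
  "solution X C c0 c1 N M s v g \<longleftrightarrow>
     g \<in> Hom X (C \<otimes> N) M \<and>
     pair X (pr1 X C N) (pr2 X C N) (bang X N \<cdot> c0) (idt X N) \<cdot> g = s \<and>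
     pair X (Tar X (pr1 X C N)) (Tar X (pr2 X C N)) (pr1 X C N \<cdot> c1) (pr2 X C N \<cdot> tzero X N)
       \<cdot> Tar X g = g \<cdot> v" for X (structure)

text \<open>The last clause asks for a solution of the system \<open>(C, c0, c1)\<close> with its own initial
  condition \<open>c0 : 1 \<rightarrow> C\<close>, not for the stronger solution \<open>C \<times> C \<rightarrow> C\<close> of \<open>(C, id, c1)\<close>.\<close>

definition curve_object ::
  "('o, 'm, 'z) cartesian_tangent_data_scheme \<Rightarrow> 'o \<Rightarrow> 'm \<Rightarrow> 'm \<Rightarrow> bool" where
  "curve_object X C c0 c1 \<longleftrightarrow>
     dynamical_system X \<^bold>1 C c0 c1 \<and>
     (\<forall>N M s v. dynamical_system X N M s v \<longrightarrow> (\<exists>\<^sub>\<le>\<^sub>1g. solution X C c0 c1 N M s v g)) \<and>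
     c1 \<cdot> Tar X c1 \<cdot> tflip X C = c1 \<cdot> Tar X c1 \<and>
     (\<exists>g. solution X C c0 c1 \<^bold>1 C c0 c1 g)" for X (structure)


section \<open>Connections on tangent display maps\<close>

text \<open>For \<open>q : E \<rightarrow> M\<close>, the vertical bundle \<open>Vq\<close> is given by its object \<open>V\<close> and its projections
  \<open>i : V \<rightarrow> TE\<close> and \<open>tv = T\<^sup>V q : V \<rightarrow> M\<close>.\<close>

definition vertical_bundle ::
  "('o, 'm, 'z) tangent_data_scheme \<Rightarrow> 'm \<Rightarrow> 'o \<Rightarrow> 'm \<Rightarrow> 'm \<Rightarrow> bool" where
  "vertical_bundle X q V i tv \<longleftrightarrow> tangent_pullback X (Tar X q) (tzero X (Cod X q)) V i tv"

definition vproj :: "('o, 'm, 'z) tangent_data_scheme \<Rightarrow> 'm \<Rightarrow> 'm \<Rightarrow> 'm" where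
  "vproj X q i = i \<cdot> tproj X (Dom X q)" for X (structure)

definition vzero :: "('o, 'm, 'z) tangent_data_scheme \<Rightarrow> 'm \<Rightarrow> 'm \<Rightarrow> 'm" where
  "vzero X q i = (THE u. u \<in> Hom X (Dom X q) (Dom X i) \<and> u \<cdot> i = tzero X (Dom X q))"
  for X (structure)

definition vlift :: "('o, 'm, 'z) tangent_data_scheme \<Rightarrow> 'm \<Rightarrow> 'm \<Rightarrow> 'm" where
  "vlift X q i = (THE u. u \<in> Hom X (Dom X i) (Tob X (Dom X i)) \<and>
     u \<cdot> Tar X i = i \<cdot> tlift X (Dom X q))" for X (structure)

text \<open>The horizontal bundle \<open>Fq\<close> is given by its object \<open>F\<close> and its projections
  \<open>qf = q\<^sup>F : F \<rightarrow> E\<close> and \<open>tf = T\<^sup>F q : F \<rightarrow> TM\<close>.\<close>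

definition horizontal_bundle ::
  "('o, 'm, 'z) tangent_data_scheme \<Rightarrow> 'm \<Rightarrow> 'o \<Rightarrow> 'm \<Rightarrow> 'm \<Rightarrow> bool" where
  "horizontal_bundle X q F qf tf \<longleftrightarrow> tangent_pullback X q (tproj X (Cod X q)) F qf tf"

definition hlift :: "('o, 'm, 'z) tangent_data_scheme \<Rightarrow> 'm \<Rightarrow> 'm \<Rightarrow> 'm \<Rightarrow> 'm" where
  "hlift X q qf tf =
     pair X (Tar X qf) (Tar X tf) (qf \<cdot> tzero X (Dom X q)) (tf \<cdot> tlift X (Cod X q))"
  for X (structure)

definition hproj :: "('o, 'm, 'z) tangent_data_scheme \<Rightarrow> 'm \<Rightarrow> 'm \<Rightarrow> 'm \<Rightarrow> 'm" where
  "hproj X q qf tf = pair X qf tf (tproj X (Dom X q)) (Tar X q)"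

definition vertical_connection ::
  "('o, 'm, 'z) tangent_data_scheme \<Rightarrow> 'm \<Rightarrow> 'o \<Rightarrow> 'm \<Rightarrow> 'm \<Rightarrow> bool" where
  "vertical_connection X q V i R \<longleftrightarrow>
     R \<in> Hom X (Tob X (Dom X q)) V \<and>
     i \<cdot> R = idt X V \<and>
     R \<cdot> vproj X q i = tproj X (Dom X q) \<and>
     R \<cdot> vlift X q i = tlift X (Dom X q) \<cdot> Tar X R" for X (structure)

definition horizontal_connection ::
  "('o, 'm, 'z) tangent_data_scheme \<Rightarrow> 'm \<Rightarrow> 'o \<Rightarrow> 'm \<Rightarrow> 'm \<Rightarrow> 'm \<Rightarrow> bool" where
  "horizontal_connection X q F qf tf H \<longleftrightarrow>
     H \<in> Hom X F (Tob X (Dom X q)) \<and>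
     H \<cdot> hproj X q qf tf = idt X F \<and>
     H \<cdot> tproj X (Dom X q) = qf \<and>
     H \<cdot> tlift X (Dom X q) = hlift X q qf tf \<cdot> Tar X H" for X (structure)

definition ehresmann_connection ::
  "('o, 'm, 'z) tangent_data_scheme \<Rightarrow> 'm \<Rightarrow> 'o \<Rightarrow> 'm \<Rightarrow> 'o \<Rightarrow> 'm \<Rightarrow> 'm \<Rightarrow> 'm \<Rightarrow> 'm \<Rightarrow> bool" where
  "ehresmann_connection X q V i F qf tf R H \<longleftrightarrow>
     vertical_connection X q V i R \<and>
     horizontal_connection X q F qf tf H \<and>
     H \<cdot> R = qf \<cdot> vzero X q i \<and>
     pair X (fst2 X (Dom X q)) (snd2 X (Dom X q)) (R \<cdot> i) (hproj X q qf tf \<cdot> H)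
       \<cdot> tplus X (Dom X q) = idt X (Tob X (Dom X q))" for X (structure)

text \<open>The vector field \<open>\<gamma>\<^sub>H = \<langle>\<pi>\<^sub>0 c\<^sub>1, \<langle>\<pi>\<^sub>0 c\<^sub>1 T\<gamma>, \<pi>\<^sub>1\<rangle> H\<rangle>\<close> on the pullback \<open>\<gamma>\<^sup>*(E)\<close> with projections
  \<open>\<pi>\<^sub>0 = a\<close> and \<open>\<pi>\<^sub>1 = b\<close>. In the inner pairing, \<open>b\<close> is the \<open>q\<^sup>F\<close>-component and
  \<open>a \<cdot> c1 \<cdot> T\<gamma>\<close> the \<open>T\<^sup>F q\<close>-component.\<close>

definition horizontal_field ::
  "('o, 'm, 'z) tangent_data_scheme \<Rightarrow> 'm \<Rightarrow> 'm \<Rightarrow> 'm \<Rightarrow> 'm \<Rightarrow> 'm \<Rightarrow> 'm \<Rightarrow> 'm \<Rightarrow> 'm" where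
  "horizontal_field X c1 qf tf H g a b =
     pair X (Tar X a) (Tar X b) (a \<cdot> c1) (pair X qf tf b (a \<cdot> c1 \<cdot> Tar X g) \<cdot> H)"
  for X (structure)

end

theory Submission
  imports Defs
begin

text \<open>
  Since \<open>C \<times> 1 \<cong> C\<close>, solutions of a dynamical system with initial condition \<open>s : 1 \<rightarrow> M\<close> are the
  same as integral curves, i.e. morphisms \<open>k : C \<rightarrow> M\<close> with \<open>c\<^sub>0 k = s\<close> and \<open>c\<^sub>1 T k = k v\<close>
  (\<open>solution_iff_integral_curve\<close>), and the curve object makes them unique. The proof is then a
  bijection between the morphisms \<open>h\<close> of the theorem and the integral curves of the horizontal
  field \<open>\<gamma>\<^sub>H\<close> on \<open>\<gamma>\<^sup>*(E)\<close> that start at \<open>\<langle>c\<^sub>0, e\<^sub>0\<rangle>\<close>.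

  If \<open>k\<close> is such an integral curve, then \<open>k \<pi>\<^sub>0\<close> is an integral curve of \<open>(C, c\<^sub>0, c\<^sub>1)\<close>. So is the
  identity, hence \<open>k \<pi>\<^sub>0 = id\<close> by uniqueness. Therefore \<open>h = k \<pi>\<^sub>1\<close> lies over \<open>\<gamma>\<close>, and the \<open>T \<pi>\<^sub>1\<close>-component of the equation for \<open>k\<close> says
  that \<open>h\<close> moves along horizontal lifts: \<open>c\<^sub>1 T h = \<langle>h, c\<^sub>1 T\<gamma>\<rangle> H\<close>. Conversely, if \<open>h\<close> lies over
  \<open>\<gamma>\<close>, starts at \<open>e\<^sub>0\<close> and moves along horizontal lifts, then \<open>\<langle>id, h\<rangle>\<close> is an integral curve of \<open>\<gamma>\<^sub>H\<close>
  that starts at \<open>\<langle>c\<^sub>0, e\<^sub>0\<rangle>\<close>. Here equations between morphisms into \<open>T \<gamma>\<^sup>*(E)\<close> are checked on the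
  components \<open>T \<pi>\<^sub>0\<close> and \<open>T \<pi>\<^sub>1\<close>, which is possible because \<open>q\<close> is a tangent display map
  (\<open>display_pullback_Tar\<close>).

  It remains to compare the horizontality equation with \<open>c\<^sub>1 T h R = h z\<^sub>q\<^sup>V\<close>
  (\<open>vanishing_vertical_part_iff_horizontal\<close>). One direction is \<open>H R = q\<^sup>F z\<^sub>q\<^sup>V\<close>; in the other
  one, the decomposition of a tangent vector as the sum of its vertical and its horizontal part
  reduces to the horizontal part, because the vertical part is zero.
\<close>

section \<open>Morphisms into pullbacks and products\<close>

lemma Hom_D:
  assumes "f \<in> Hom X A B"
  shows "f \<in> Arr X" "Dom X f = A" "Cod X f = B"
  using assms by (auto simp: Hom_def)

context category
begin

lemma Hom_Obj:
  assumes "f \<in> Hom X A B"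
  shows "A \<in> Obj X" "B \<in> Obj X"
  using assms Dom_in Cod_in by (auto simp: Hom_def)

lemma pullback_projs:
  assumes "is_pullback X f g P a b" "f \<in> Hom X A D" "g \<in> Hom X B D"
  shows "a \<in> Hom X P A" "b \<in> Hom X P B" "a \<cdot> f = b \<cdot> g"
  using assms by (auto simp: is_pullback_def Hom_D)

lemma pullback_factor:
  assumes "is_pullback X f g P a b" "f \<in> Hom X A D" "g \<in> Hom X B D"
    and "x \<in> Hom X Y A" "y \<in> Hom X Y B" "x \<cdot> f = y \<cdot> g"
  shows "\<exists>!u. u \<in> Hom X Y P \<and> u \<cdot> a = x \<and> u \<cdot> b = y"
  using assms Hom_Obj(1)[OF assms(4)] unfolding is_pullback_def by (auto simp: Hom_D)

lemma pullback_eqI: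
  assumes "is_pullback X f g P a b" "f \<in> Hom X A D" "g \<in> Hom X B D"
    and u: "u \<in> Hom X Y P" and v: "v \<in> Hom X Y P"
    and "u \<cdot> a = v \<cdot> a" "u \<cdot> b = v \<cdot> b"
  shows "u = v"
proof -
  note ab = pullback_projs[OF assms(1-3)]
  have "v \<cdot> a \<cdot> f = v \<cdot> b \<cdot> g"
    using cmp_assoc[OF v ab(1) assms(2)] cmp_assoc[OF v ab(2) assms(3)] ab(3) by simp
  with pullback_factor[OF assms(1-3) cmp_in[OF v ab(1)] cmp_in[OF v ab(2)]]
  show ?thesis using assms by blast
qed

lemma pair_pullback:
  assumes "is_pullback X f g P a b" "f \<in> Hom X A D" "g \<in> Hom X B D"
    and "x \<in> Hom X Y A" "y \<in> Hom X Y B" "x \<cdot> f = y \<cdot> g"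
  shows "pair X a b x y \<in> Hom X Y P" "pair X a b x y \<cdot> a = x" "pair X a b x y \<cdot> b = y"
  using theI'[OF pullback_factor[OF assms]] pullback_projs[OF assms(1-3)] assms(4)
  by (simp_all add: pair_def Hom_D)

lemma cmp_pair_pullback:
  assumes "is_pullback X f g P a b" "f \<in> Hom X A D" "g \<in> Hom X B D"
    and "x \<in> Hom X Y A" "y \<in> Hom X Y B" "x \<cdot> f = y \<cdot> g" and u: "u \<in> Hom X Z Y"
  shows "u \<cdot> pair X a b x y = pair X a b (u \<cdot> x) (u \<cdot> y)"
proof -
  note ab = pullback_projs[OF assms(1-3)]
  note xy = pair_pullback[OF assms(1-6)]
  have "u \<cdot> x \<cdot> f = u \<cdot> y \<cdot> g"
    using assms(6) cmp_assoc[OF u assms(4,2)] cmp_assoc[OF u assms(5,3)] by simp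
  note uxy = pair_pullback[OF assms(1-3) cmp_in[OF u assms(4)] cmp_in[OF u assms(5)] this]
  show ?thesis
    by (rule pullback_eqI[OF assms(1-3) cmp_in[OF u xy(1)] uxy(1)])
      (simp_all add: cmp_assoc[OF u xy(1) ab(1)] cmp_assoc[OF u xy(1) ab(2)] xy uxy)
qed

lemma pullback_transport:
  assumes pb: "is_pullback X f g P a b" and f: "f \<in> Hom X A D" and g: "g \<in> Hom X B D"
    and u: "u \<in> Hom X Q P" and w: "w \<in> Hom X P Q"
    and uw: "u \<cdot> w = idt X Q" and wu: "w \<cdot> u = idt X P"
  shows "is_pullback X f g Q (u \<cdot> a) (u \<cdot> b)"
proof -
  note ab = pullback_projs[OF pb f g]
  have square: "u \<cdot> a \<cdot> f = u \<cdot> b \<cdot> g"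
    using cmp_assoc[OF u ab(1) f] cmp_assoc[OF u ab(2) g] ab(3) by simp
  have "\<exists>!v. v \<in> Hom X Y Q \<and> v \<cdot> (u \<cdot> a) = x \<and> v \<cdot> (u \<cdot> b) = y"
    if x: "x \<in> Hom X Y A" and y: "y \<in> Hom X Y B" and eq: "x \<cdot> f = y \<cdot> g" for Y x y
  proof -
    obtain t where t: "t \<in> Hom X Y P" "t \<cdot> a = x" "t \<cdot> b = y"
      using pullback_factor[OF pb f g x y eq] by blast
    have tw: "t \<cdot> w \<cdot> u = t"
      using cmp_assoc[OF t(1) w u] wu cmp_idt[OF t(1)] by simp
    show ?thesis
    proof (rule ex1I[of _ "t \<cdot> w"])
      show "t \<cdot> w \<in> Hom X Y Q \<and> t \<cdot> w \<cdot> (u \<cdot> a) = x \<and> t \<cdot> w \<cdot> (u \<cdot> b) = y"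
        using cmp_in[OF t(1) w] cmp_assoc[OF cmp_in[OF t(1) w] u ab(1)]
          cmp_assoc[OF cmp_in[OF t(1) w] u ab(2)] tw t by simp
    next
      fix v assume v: "v \<in> Hom X Y Q \<and> v \<cdot> (u \<cdot> a) = x \<and> v \<cdot> (u \<cdot> b) = y"
      then have v': "v \<in> Hom X Y Q" by blast
      have "v \<cdot> u = t"
        by (rule pullback_eqI[OF pb f g cmp_in[OF v' u] t(1)])
          (use v t cmp_assoc[OF v' u ab(1)] cmp_assoc[OF v' u ab(2)] in simp_all)
      then show "v = t \<cdot> w"
        using cmp_assoc[OF v' u w] uw cmp_idt[OF v'] by simp
    qed
  qed
  then show ?thesis
    using cmp_in[OF u ab(1)] cmp_in[OF u ab(2)] square f g
    by (auto simp: is_pullback_def Hom_D)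
qed

lemma pullbacks_isomorphic:
  assumes pb: "is_pullback X f g P a b" and pb': "is_pullback X f g P' a' b'"
    and f: "f \<in> Hom X A D" and g: "g \<in> Hom X B D"
  obtains u w where "u \<in> Hom X P P'" "w \<in> Hom X P' P"
    "u \<cdot> w = idt X P" "w \<cdot> u = idt X P'" "u \<cdot> a' = a" "u \<cdot> b' = b"
proof -
  note ab = pullback_projs[OF pb f g] and ab' = pullback_projs[OF pb' f g]
  obtain u where u: "u \<in> Hom X P P'" "u \<cdot> a' = a" "u \<cdot> b' = b"
    using pullback_factor[OF pb' f g ab] by blast
  obtain w where w: "w \<in> Hom X P' P" "w \<cdot> a = a'" "w \<cdot> b = b'"
    using pullback_factor[OF pb f g ab'] by blast
  have "u \<cdot> w = idt X P"
    by (rule pullback_eqI[OF pb f g cmp_in[OF u(1) w(1)] idt_in[OF Hom_Obj(1)[OF u(1)]]])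
      (simp_all add: cmp_assoc[OF u(1) w(1) ab(1)] cmp_assoc[OF u(1) w(1) ab(2)] u w
        idt_cmp[OF ab(1)] idt_cmp[OF ab(2)])
  moreover have "w \<cdot> u = idt X P'"
    by (rule pullback_eqI[OF pb' f g cmp_in[OF w(1) u(1)] idt_in[OF Hom_Obj(1)[OF w(1)]]])
      (simp_all add: cmp_assoc[OF w(1) u(1) ab'(1)] cmp_assoc[OF w(1) u(1) ab'(2)] u w
        idt_cmp[OF ab'(1)] idt_cmp[OF ab'(2)])
  ultimately show thesis using that u w by blast
qed

lemma product_projs:
  assumes "is_product X A B P a b"
  shows "a \<in> Hom X P A" "b \<in> Hom X P B"
  using assms by (auto simp: is_product_def)

lemma product_factor:
  assumes "is_product X A B P a b" "x \<in> Hom X Y A" "y \<in> Hom X Y B"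
  shows "\<exists>!u. u \<in> Hom X Y P \<and> u \<cdot> a = x \<and> u \<cdot> b = y"
  using assms Hom_Obj(1)[OF assms(2)] by (simp add: is_product_def)

lemma pair_product:
  assumes "is_product X A B P a b" "x \<in> Hom X Y A" "y \<in> Hom X Y B"
  shows "pair X a b x y \<in> Hom X Y P" "pair X a b x y \<cdot> a = x" "pair X a b x y \<cdot> b = y"
  using theI'[OF product_factor[OF assms]] product_projs[OF assms(1)] assms(2)
  by (simp_all add: pair_def Hom_D)

end


section \<open>Pullbacks and zero vectors in tangent categories\<close>

context tangent_category
begin

lemma tangent_pullback_is_pullback:
  assumes "tangent_pullback X f g P a b"
  shows "is_pullback X f g P a b"
  using assms[unfolded tangent_pullback_def, rule_format, of 0] by simp

lemma tangent_pullback_Tar: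
  assumes "tangent_pullback X f g P a b"
  shows "is_pullback X (Tar X f) (Tar X g) (Tob X P) (Tar X a) (Tar X b)"
  using assms[unfolded tangent_pullback_def, rule_format, of 1] by simp

text \<open>A display map has some pullback along \<open>f\<close> that \<open>T\<close> preserves; being preserved by \<open>T\<close> is
  invariant under isomorphism, and so passes to every other pullback of the same cospan.\<close>

lemma display_pullback_Tar:
  assumes display: "tangent_display_map X q" and pb: "is_pullback X f q P a b"
    and f: "f \<in> Hom X N M" and q: "q \<in> Hom X E M"
  shows "is_pullback X (Tar X f) (Tar X q) (Tob X P) (Tar X a) (Tar X b)"
proof -
  have "\<exists>P' a' b'. tangent_pullback X f ((Tar X ^^ 0) q) P' a' b'"
    using display f q Hom_Obj(1)[OF f] unfolding tangent_display_map_def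
    by (metis Hom_D(3) funpow_0)
  then obtain P' a' b' where tpb: "tangent_pullback X f q P' a' b'" by auto
  note pb' = tangent_pullback_is_pullback[OF tpb]
  obtain u w where u: "u \<in> Hom X P P'" and w: "w \<in> Hom X P' P"
    and uw: "u \<cdot> w = idt X P" and wu: "w \<cdot> u = idt X P'"
    and a: "u \<cdot> a' = a" and b: "u \<cdot> b' = b"
    using pullbacks_isomorphic[OF pb pb' f q] by blast
  have "Tar X u \<cdot> Tar X w = idt X (Tob X P)" "Tar X w \<cdot> Tar X u = idt X (Tob X P')"
    using Tar_cmp[OF u w] Tar_cmp[OF w u] uw wu
      Tar_idt[OF Hom_Obj(1)[OF u]] Tar_idt[OF Hom_Obj(1)[OF w]] by simp_all
  from pullback_transport[OF tangent_pullback_Tar[OF tpb] Tar_in[OF f] Tar_in[OF q]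
      Tar_in[OF u] Tar_in[OF w] this]
  show ?thesis
    using Tar_cmp[OF u pullback_projs(1)[OF pb' f q]] Tar_cmp[OF u pullback_projs(2)[OF pb' f q]]
      a b by simp
qed

lemma zero_plus:
  assumes x: "x \<in> Hom X Y (Tob X M)" and M: "M \<in> Obj X"
  shows "pair X (fst2 X M) (snd2 X M) (x \<cdot> tproj X M \<cdot> tzero X M) x \<cdot> tplus X M = x"
proof -
  let ?o = "x \<cdot> tproj X M \<cdot> tzero X M"
  note p = tproj_in[OF M] and z = tzero_in[OF M]
  have add: "additive_bundle X (tbundle X M)" by (rule tbundle_additive[OF M])
  have Y: "Y \<in> Obj X" using Hom_Obj(1)[OF x] .
  have o: "?o \<in> Hom X Y (Tob X M)" using cmp_in[OF cmp_in[OF x p] z] .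
  have zp: "tzero X M \<cdot> tproj X M = idt X M"
    using add Hom_D[OF p] by (simp add: additive_bundle_def Let_def tbundle_def)
  have op: "?o \<cdot> tproj X M = x \<cdot> tproj X M"
    using cmp_assoc[OF cmp_in[OF x p] z p] zp cmp_idt[OF cmp_in[OF x p]] by simp
  have "bsum X (tbundle X M) ?o x = bsum X (tbundle X M) x ?o"
    using add Hom_D[OF p] Y x o op by (simp add: additive_bundle_def Let_def tbundle_def)
  also have "\<dots> = x"
    using add Hom_D[OF p] Y x by (simp add: additive_bundle_def Let_def tbundle_def)
  finally show ?thesis by (simp add: bsum_def tbundle_def)
qed

lemma vzero_props:
  assumes q: "q \<in> Hom X E M" and vb: "vertical_bundle X q V i tv"
  shows "i \<in> Hom X V (Tob X E)" "vzero X q i \<in> Hom X E V" "vzero X q i \<cdot> i = tzero X E"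
proof -
  have E: "E \<in> Obj X" and M: "M \<in> Obj X" using Hom_Obj[OF q] by auto
  have pb: "is_pullback X (Tar X q) (tzero X M) V i tv"
    using vb Hom_D[OF q] tangent_pullback_is_pullback by (simp add: vertical_bundle_def)
  note z = tzero_in[OF M] and Tq = Tar_in[OF q]
  show i: "i \<in> Hom X V (Tob X E)" using pullback_projs[OF pb Tq z] by simp
  note tv = pullback_projs[OF pb Tq z]
  obtain u where u: "u \<in> Hom X E V" "u \<cdot> i = tzero X E" "u \<cdot> tv = q"
    using pullback_factor[OF pb Tq z tzero_in[OF E] q tzero_natural[OF q, symmetric]] by blast
  have "\<exists>!u. u \<in> Hom X E V \<and> u \<cdot> i = tzero X E"
  proof (rule ex1I[of _ u])
    show "u \<in> Hom X E V \<and> u \<cdot> i = tzero X E" using u by simp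
  next
    fix v assume v: "v \<in> Hom X E V \<and> v \<cdot> i = tzero X E"
    then have v': "v \<in> Hom X E V" by blast
    \<comment> \<open>The inclusion \<open>i\<close> is monic: \<open>z\<^sub>M\<close> is a section of \<open>p\<^sub>M\<close>, so \<open>T\<^sup>V q\<close> is determined by \<open>i T q\<close>.\<close>
    have zp: "tzero X M \<cdot> tproj X M = idt X M"
      using tbundle_additive[OF M] Hom_D[OF tproj_in[OF M]]
      by (simp add: additive_bundle_def Let_def tbundle_def)
    have tv_eq: "w \<cdot> tv = w \<cdot> i \<cdot> Tar X q \<cdot> tproj X M" if w: "w \<in> Hom X E V" for w
    proof -
      have "w \<cdot> i \<cdot> Tar X q = w \<cdot> tv \<cdot> tzero X M"
        using cmp_assoc[OF w tv(1) Tq] cmp_assoc[OF w tv(2) z] tv(3) by simp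
      then show ?thesis
        using cmp_assoc[OF cmp_in[OF w tv(2)] z tproj_in[OF M]] zp
          cmp_idt[OF cmp_in[OF w tv(2)]] by simp
    qed
    show "v = u"
      by (rule pullback_eqI[OF pb Tq z v' u(1)])
        (use v u(2) tv_eq[OF v'] tv_eq[OF u(1)] in simp_all)
  qed
  from theI'[OF this] show "vzero X q i \<in> Hom X E V" "vzero X q i \<cdot> i = tzero X E"
    using Hom_D[OF q] Hom_D[OF i] by (simp_all add: vzero_def)
qed


section \<open>Horizontal tangent vectors\<close>

text \<open>A tangent vector \<open>w\<close> of \<open>E\<close> at \<open>h\<close> has zero vertical part iff it is the horizontal lift at
  \<open>h\<close> of its image \<open>w T q\<close>. The lift of any vector has zero vertical part by \<open>H R = q\<^sup>F z\<^sub>q\<^sup>V\<close>; and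
  if the vertical part of \<open>w\<close> is zero, the decomposition
  \<open>\<langle>R \<iota>\<^sub>q, \<pi>\<^sub>q H\<rangle> s\<^sub>E = id\<close> leaves only the horizontal part of \<open>w\<close>.\<close>

lemma vanishing_vertical_part_iff_horizontal:
  assumes q: "q \<in> Hom X E M"
    and vb: "vertical_bundle X q V i tv" and hb: "horizontal_bundle X q F qf tf"
    and conn: "ehresmann_connection X q V i F qf tf R H"
    and w: "w \<in> Hom X Y (Tob X E)"
  shows "w \<cdot> R = w \<cdot> tproj X E \<cdot> vzero X q i \<longleftrightarrow>
    w = pair X qf tf (w \<cdot> tproj X E) (w \<cdot> Tar X q) \<cdot> H"
proof -
  have E: "E \<in> Obj X" and M: "M \<in> Obj X" using Hom_Obj[OF q] by auto
  note p = tproj_in[OF E] and Tq = Tar_in[OF q] and pM = tproj_in[OF M]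
  note vz = vzero_props[OF q vb]
  have pb: "is_pullback X q (tproj X M) F qf tf"
    using hb Hom_D[OF q] tangent_pullback_is_pullback by (simp add: horizontal_bundle_def)
  have R: "R \<in> Hom X (Tob X E) V" and Rp: "R \<cdot> (i \<cdot> tproj X E) = tproj X E"
    and H: "H \<in> Hom X F (Tob X E)" and Hp: "H \<cdot> tproj X E = qf"
    and HR: "H \<cdot> R = qf \<cdot> vzero X q i"
    and dec: "pair X (fst2 X E) (snd2 X E) (R \<cdot> i) (hproj X q qf tf \<cdot> H) \<cdot> tplus X E =
      idt X (Tob X E)"
    using conn Hom_D[OF q]
    by (auto simp: ehresmann_connection_def vertical_connection_def horizontal_connection_def
        vproj_def)
  note qf = pullback_projs[OF pb q pM]
  let ?hor = "pair X qf tf (tproj X E) (Tar X q)"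
  note hor = pair_pullback[OF pb q pM p Tq tproj_natural[OF q, symmetric]]
  have hproj: "hproj X q qf tf = ?hor" using Hom_D[OF q] by (simp add: hproj_def)
  have w_hor: "w \<cdot> ?hor = pair X qf tf (w \<cdot> tproj X E) (w \<cdot> Tar X q)"
    by (rule cmp_pair_pullback[OF pb q pM p Tq tproj_natural[OF q, symmetric] w])
  show ?thesis
  proof
    assume "w = pair X qf tf (w \<cdot> tproj X E) (w \<cdot> Tar X q) \<cdot> H"
    then have "w \<cdot> R = w \<cdot> ?hor \<cdot> H \<cdot> R" using w_hor by simp
    also have "\<dots> = w \<cdot> ?hor \<cdot> qf \<cdot> vzero X q i"
      using cmp_assoc[OF cmp_in[OF w hor(1)] H R] HR
        cmp_assoc[OF cmp_in[OF w hor(1)] qf(1) vz(2)] by simp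
    also have "w \<cdot> ?hor \<cdot> qf = w \<cdot> tproj X E"
      using cmp_assoc[OF w hor(1) qf(1)] hor(2) by simp
    finally show "w \<cdot> R = w \<cdot> tproj X E \<cdot> vzero X q i" .
  next
    assume vert: "w \<cdot> R = w \<cdot> tproj X E \<cdot> vzero X q i"
    have pbT: "is_pullback X (tproj X E) (tproj X E) (T2 X E) (fst2 X E) (snd2 X E)"
      using T2_pullback[OF E] by (rule tangent_pullback_is_pullback)
    have hHp: "?hor \<cdot> H \<cdot> tproj X E = tproj X E"
      using cmp_assoc[OF hor(1) H p] Hp hor(2) by simp
    have same_base: "R \<cdot> i \<cdot> tproj X E = ?hor \<cdot> H \<cdot> tproj X E"
      using cmp_assoc[OF R vz(1) p] Rp hHp by simp
    let ?sum = "\<lambda>x y. pair X (fst2 X E) (snd2 X E) x y \<cdot> tplus X E"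
    note Ri = cmp_in[OF R vz(1)] and hH = cmp_in[OF hor(1) H]
    note parts = pair_pullback(1)[OF pbT p p Ri hH same_base]
    have "w = w \<cdot> ?sum (R \<cdot> i) (?hor \<cdot> H)"
      using dec cmp_idt[OF w] by (simp add: hproj)
    also have "\<dots> = w \<cdot> pair X (fst2 X E) (snd2 X E) (R \<cdot> i) (?hor \<cdot> H) \<cdot> tplus X E"
      using cmp_assoc[OF w parts tplus_in[OF E]] by simp
    also have "\<dots> = ?sum (w \<cdot> (R \<cdot> i)) (w \<cdot> (?hor \<cdot> H))"
      using cmp_pair_pullback[OF pbT p p Ri hH same_base w] by simp
    also have "w \<cdot> (R \<cdot> i) = w \<cdot> (?hor \<cdot> H) \<cdot> tproj X E \<cdot> tzero X E"
    proof -
      have "w \<cdot> (R \<cdot> i) = w \<cdot> tproj X E \<cdot> tzero X E"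
        using cmp_assoc[OF w R vz(1)] vert cmp_assoc[OF cmp_in[OF w p] vz(2,1)] vz(3) by simp
      also have "w \<cdot> tproj X E = w \<cdot> (?hor \<cdot> H) \<cdot> tproj X E"
        using cmp_assoc[OF w hH p] hHp by simp
      finally show ?thesis .
    qed
    also have "?sum \<dots> (w \<cdot> (?hor \<cdot> H)) = w \<cdot> (?hor \<cdot> H)"
      by (rule zero_plus[OF cmp_in[OF w hH] E])
    finally show "w = pair X qf tf (w \<cdot> tproj X E) (w \<cdot> Tar X q) \<cdot> H"
      using cmp_assoc[OF w hor(1) H] w_hor by simp
  qed
qed

end


section \<open>Integral curves\<close>

definition integral_curve ::
  "('o, 'm, 'z) tangent_data_scheme \<Rightarrow> 'o \<Rightarrow> 'm \<Rightarrow> 'm \<Rightarrow> 'o \<Rightarrow> 'm \<Rightarrow> 'm \<Rightarrow> 'm \<Rightarrow> bool" where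
  "integral_curve X C c0 c1 M s v k \<longleftrightarrow>
     k \<in> Hom X C M \<and> c0 \<cdot> k = s \<and> c1 \<cdot> Tar X k = k \<cdot> v" for X (structure)

context cartesian_tangent_category
begin

lemma one_Obj: "\<^bold>1 \<in> Obj X"
  using one_terminal by (simp add: is_terminal_def)

lemma into_one_unique:
  assumes "f \<in> Hom X A \<^bold>1" "g \<in> Hom X A \<^bold>1"
  shows "f = g"
  using assms one_terminal Hom_Obj(1)[OF assms(1)] by (auto simp: is_terminal_def)

lemma bang_in:
  assumes "A \<in> Obj X"
  shows "bang X A \<in> Hom X A \<^bold>1"
  using assms one_terminal theI'[of "\<lambda>f. f \<in> Hom X A \<^bold>1"] by (auto simp: is_terminal_def bang_def)

lemma pr1_one_inverse:
  assumes C: "C \<in> Obj X"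
  obtains u where "u \<in> Hom X C (C \<otimes> \<^bold>1)" "u \<cdot> pr1 X C \<^bold>1 = idt X C"
    "pr1 X C \<^bold>1 \<cdot> u = idt X (C \<otimes> \<^bold>1)"
proof -
  note prod = prd_product[OF C one_Obj]
  note pr = product_projs[OF prod]
  obtain u where u: "u \<in> Hom X C (C \<otimes> \<^bold>1)" "u \<cdot> pr1 X C \<^bold>1 = idt X C"
    using product_factor[OF prod idt_in[OF C] bang_in[OF C]] by blast
  have P: "C \<otimes> \<^bold>1 \<in> Obj X" using Hom_Obj(2)[OF u(1)] .
  have "pr1 X C \<^bold>1 \<cdot> u \<cdot> pr1 X C \<^bold>1 = pr1 X C \<^bold>1"
    using cmp_assoc[OF pr(1) u(1) pr(1)] u(2) cmp_idt[OF pr(1)] by simp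
  moreover have "pr1 X C \<^bold>1 \<cdot> u \<cdot> pr2 X C \<^bold>1 = pr2 X C \<^bold>1"
    by (rule into_one_unique[OF cmp_in[OF cmp_in[OF pr(1) u(1)] pr(2)] pr(2)])
  ultimately have "pr1 X C \<^bold>1 \<cdot> u = idt X (C \<otimes> \<^bold>1)"
    using product_factor[OF prod pr(1) pr(2)] cmp_in[OF pr(1) u(1)] idt_in[OF P]
      idt_cmp[OF pr(1)] idt_cmp[OF pr(2)] by blast
  with u that show thesis by blast
qed

text \<open>For \<open>N = 1\<close> the factor \<open>N\<close> carries no information: \<open>\<pi>\<^sub>1 : C \<times> 1 \<rightarrow> C\<close> is an isomorphism, and
  composing the two solution equations with it removes the pairings.\<close>

lemma solution_iff_integral_curve:
  assumes c0: "c0 \<in> Hom X \<^bold>1 C" and c1: "c1 \<in> Hom X C (Tob X C)"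
    and k: "k \<in> Hom X C M" and v: "v \<in> Hom X M (Tob X M)"
  shows "solution X C c0 c1 \<^bold>1 M s v (pr1 X C \<^bold>1 \<cdot> k) \<longleftrightarrow> integral_curve X C c0 c1 M s v k"
proof -
  have C: "C \<in> Obj X" using Hom_Obj(2)[OF c0] .
  let ?p = "pr1 X C \<^bold>1" and ?r = "pr2 X C \<^bold>1"
  note prod = prd_product[OF C one_Obj] and Tprod = Tob_prd_product[OF C one_Obj]
  note pr = product_projs[OF prod] and Tk = Tar_in[OF k]
  obtain u where u: "u \<in> Hom X C (C \<otimes> \<^bold>1)" "u \<cdot> ?p = idt X C"
    using pr1_one_inverse[OF C] by blast
  have pc1: "?p \<cdot> c1 \<in> Hom X (C \<otimes> \<^bold>1) (Tob X C)" using cmp_in[OF pr(1) c1] .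
  have rz: "?r \<cdot> tzero X \<^bold>1 \<in> Hom X (C \<otimes> \<^bold>1) (Tob X \<^bold>1)"
    using cmp_in[OF pr(2) tzero_in[OF one_Obj]] .
  have bang_one: "bang X \<^bold>1 = idt X \<^bold>1"
    by (rule into_one_unique[OF bang_in[OF one_Obj] idt_in[OF one_Obj]])
  note start = pair_product[OF prod c0 idt_in[OF one_Obj]]
  note vel = pair_product[OF Tprod pc1 rz]
  have initial: "pair X ?p ?r (bang X \<^bold>1 \<cdot> c0) (idt X \<^bold>1) \<cdot> (?p \<cdot> k) = c0 \<cdot> k"
    using start(2) cmp_assoc[OF start(1) pr(1) k] bang_one idt_cmp[OF c0] by simp
  have velocity: "pair X (Tar X ?p) (Tar X ?r) (?p \<cdot> c1) (?r \<cdot> tzero X \<^bold>1) \<cdot> Tar X (?p \<cdot> k) =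
      ?p \<cdot> (c1 \<cdot> Tar X k)"
    using Tar_cmp[OF pr(1) k] cmp_assoc[OF vel(1) Tar_in[OF pr(1)] Tk] vel(2)
      cmp_assoc[OF pr(1) c1 Tk] by simp
  have cancel: "?p \<cdot> a = ?p \<cdot> b \<longleftrightarrow> a = b"
    if ab: "a \<in> Hom X C (Tob X M)" "b \<in> Hom X C (Tob X M)" for a b
  proof
    assume "?p \<cdot> a = ?p \<cdot> b"
    then have "u \<cdot> ?p \<cdot> a = u \<cdot> ?p \<cdot> b"
      using cmp_assoc[OF u(1) pr(1) ab(1)] cmp_assoc[OF u(1) pr(1) ab(2)] by simp
    then show "a = b" using u(2) idt_cmp[OF ab(1)] idt_cmp[OF ab(2)] by simp
  qed simp
  show ?thesis
    unfolding solution_def integral_curve_def initial velocity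
    using cancel[OF cmp_in[OF c1 Tk] cmp_in[OF k v]] cmp_assoc[OF pr(1) k v] cmp_in[OF pr(1) k] k
    by simp
qed

lemma solution_integral_curve:
  assumes c0: "c0 \<in> Hom X \<^bold>1 C" and c1: "c1 \<in> Hom X C (Tob X C)"
    and v: "v \<in> Hom X M (Tob X M)" and g: "solution X C c0 c1 \<^bold>1 M s v g"
  shows "\<exists>k. integral_curve X C c0 c1 M s v k"
proof -
  have C: "C \<in> Obj X" using Hom_Obj(2)[OF c0] .
  have gH: "g \<in> Hom X (C \<otimes> \<^bold>1) M" using g by (simp add: solution_def)
  obtain u where u: "u \<in> Hom X C (C \<otimes> \<^bold>1)" "pr1 X C \<^bold>1 \<cdot> u = idt X (C \<otimes> \<^bold>1)"
    using pr1_one_inverse[OF C] by blast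
  have "pr1 X C \<^bold>1 \<cdot> (u \<cdot> g) = g"
    using cmp_assoc[OF product_projs(1)[OF prd_product[OF C one_Obj]] u(1) gH] u(2) idt_cmp[OF gH]
    by simp
  then show ?thesis
    using solution_iff_integral_curve[OF c0 c1 cmp_in[OF u(1) gH] v] g by metis
qed

lemma integral_curve_unique:
  assumes curve: "curve_object X C c0 c1" and sys: "dynamical_system X \<^bold>1 M s v"
    and k: "integral_curve X C c0 c1 M s v k" and k': "integral_curve X C c0 c1 M s v k'"
  shows "k = k'"
proof -
  have c0: "c0 \<in> Hom X \<^bold>1 C" and c1: "c1 \<in> Hom X C (Tob X C)"
    using curve by (auto simp: curve_object_def dynamical_system_def vector_field_def)
  have v: "v \<in> Hom X M (Tob X M)"
    using sys by (simp add: dynamical_system_def vector_field_def)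
  have kH: "k \<in> Hom X C M" "k' \<in> Hom X C M" using k k' by (auto simp: integral_curve_def)
  have C: "C \<in> Obj X" using Hom_Obj(2)[OF c0] .
  note pr = product_projs(1)[OF prd_product[OF C one_Obj]]
  obtain u where u: "u \<in> Hom X C (C \<otimes> \<^bold>1)" "u \<cdot> pr1 X C \<^bold>1 = idt X C"
    using pr1_one_inverse[OF C] by blast
  have "\<exists>\<^sub>\<le>\<^sub>1g. solution X C c0 c1 \<^bold>1 M s v g"
    using curve sys by (simp add: curve_object_def)
  then have "pr1 X C \<^bold>1 \<cdot> k = pr1 X C \<^bold>1 \<cdot> k'"
    using solution_iff_integral_curve[OF c0 c1 kH(1) v] solution_iff_integral_curve[OF c0 c1 kH(2) v]
      k k' by (auto dest: Uniq_D)
  then have "u \<cdot> pr1 X C \<^bold>1 \<cdot> k = u \<cdot> pr1 X C \<^bold>1 \<cdot> k'"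
    using cmp_assoc[OF u(1) pr kH(1)] cmp_assoc[OF u(1) pr kH(2)] by simp
  then show ?thesis using u(2) idt_cmp[OF kH(1)] idt_cmp[OF kH(2)] by simp
qed

end


section \<open>Parallel transport\<close>

theorem theorem6p22:
  fixes X :: "('o, 'm, 'z) cartesian_tangent_data_scheme" (structure)
  assumes "cartesian_tangent_category X"
    and "curve_object X C c0 c1"
    and "q \<in> Hom X E M"
    and "tangent_display_map X q"
    and "vertical_bundle X q V i tv"
    and "horizontal_bundle X q F qf tf"
    and "ehresmann_connection X q V i F qf tf R H"
    and "\<gamma> \<in> Hom X C M"
    and "e0 \<in> Hom X \<^bold>1 E"
    and "e0 \<cdot> q = c0 \<cdot> \<gamma>"
    and "is_pullback X \<gamma> q G p0 p1"
    and "\<exists>\<psi>. solution X C c0 c1 \<^bold>1 G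
               (pair X p0 p1 c0 e0) (horizontal_field X c1 qf tf H \<gamma> p0 p1) \<psi>"
  shows "\<exists>!h. h \<in> Hom X C E \<and>
              c0 \<cdot> h = e0 \<and>
              h \<cdot> q = \<gamma> \<and>
              c1 \<cdot> Tar X h \<cdot> R = h \<cdot> vzero X q i"
proof -
  interpret cartesian_tangent_category X by fact
  note curve = assms(2) and q = assms(3) and vb = assms(5) and hb = assms(6) and conn = assms(7)
    and \<gamma> = assms(8) and e0 = assms(9) and e0q = assms(10) and pb = assms(11)
  have sysC: "dynamical_system X \<^bold>1 C c0 c1" using curve by (simp add: curve_object_def)
  have c0: "c0 \<in> Hom X \<^bold>1 C" and c1: "c1 \<in> Hom X C (Tob X C)"
    and c1p: "c1 \<cdot> tproj X C = idt X C"
    using sysC by (auto simp: dynamical_system_def vector_field_def)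
  have E: "E \<in> Obj X" and M: "M \<in> Obj X" and C: "C \<in> Obj X"
    using Hom_Obj[OF q] Hom_Obj[OF c0] by auto
  note pE = tproj_in[OF E] and pM = tproj_in[OF M] and pC = tproj_in[OF C]
    and Tq = Tar_in[OF q] and T\<gamma> = Tar_in[OF \<gamma>]
  have pbF: "is_pullback X q (tproj X M) F qf tf"
    using hb Hom_D[OF q] tangent_pullback_is_pullback by (simp add: horizontal_bundle_def)
  note qf = pullback_projs[OF pbF q pM]
  have H: "H \<in> Hom X F (Tob X E)" and Hp: "H \<cdot> tproj X E = qf"
    and Hhor: "H \<cdot> pair X qf tf (tproj X E) (Tar X q) = idt X F"
    using conn Hom_D[OF q]
    by (auto simp: ehresmann_connection_def horizontal_connection_def hproj_def)
  note hor = pair_pullback[OF pbF q pM pE Tq tproj_natural[OF q, symmetric]]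
  \<comment> \<open>\<open>H\<close> is a section of \<open>\<pi>\<^sub>q\<close>, so a horizontal lift projects to the vector it lifts.\<close>
  have HTq: "H \<cdot> Tar X q = tf"
    using cmp_assoc[OF H hor(1) qf(2)] Hhor hor(3) idt_cmp[OF qf(2)] by simp
  note p = pullback_projs[OF pb \<gamma> q]
  have G: "G \<in> Obj X" using Hom_Obj(1)[OF p(1)] .
  note pG = tproj_in[OF G] and Tp0 = Tar_in[OF p(1)] and Tp1 = Tar_in[OF p(2)]
  have Tpb: "is_pullback X (Tar X \<gamma>) (Tar X q) (Tob X G) (Tar X p0) (Tar X p1)"
    by (rule display_pullback_Tar[OF assms(4) pb \<gamma> q])

  have c1\<gamma>: "c1 \<cdot> Tar X \<gamma> \<in> Hom X C (Tob X M)" using cmp_in[OF c1 T\<gamma>] .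
  have c1\<gamma>p: "c1 \<cdot> Tar X \<gamma> \<cdot> tproj X M = \<gamma>"
    using cmp_assoc[OF c1 T\<gamma> pM] tproj_natural[OF \<gamma>] cmp_assoc[OF c1 pC \<gamma>] c1p idt_cmp[OF \<gamma>]
    by simp

  let ?vel = "p0 \<cdot> c1 \<cdot> Tar X \<gamma>"
  let ?s = "pair X p0 p1 c0 e0" and ?v = "horizontal_field X c1 qf tf H \<gamma> p0 p1"
  have p0c1: "p0 \<cdot> c1 \<in> Hom X G (Tob X C)" using cmp_in[OF p(1) c1] .
  have vel: "?vel \<in> Hom X G (Tob X M)" using cmp_in[OF p0c1 T\<gamma>] .
  have over: "p1 \<cdot> q = ?vel \<cdot> tproj X M"
    using cmp_assoc[OF p(1) c1 T\<gamma>] cmp_assoc[OF p(1) c1\<gamma> pM] c1\<gamma>p p(3) by simp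
  note lift = pair_pullback[OF pbF q pM p(2) vel over]
  let ?L = "pair X qf tf p1 ?vel"
  note LH = cmp_in[OF lift(1) H]
  have LHq: "?vel = ?L \<cdot> H \<cdot> Tar X q"
    using cmp_assoc[OF lift(1) H Tq] HTq lift(3) by simp
  have v: "?v \<in> Hom X G (Tob X G)" "?v \<cdot> Tar X p0 = p0 \<cdot> c1" "?v \<cdot> Tar X p1 = ?L \<cdot> H"
    using pair_pullback[OF Tpb T\<gamma> Tq p0c1 LH LHq] by (simp_all add: horizontal_field_def)
  \<comment> \<open>Both components of \<open>\<gamma>\<^sub>H\<close> have the right base point: \<open>c\<^sub>1\<close> is a vector field and a
    horizontal lift \<open>\<langle>e, u\<rangle> H\<close> is a tangent vector at \<open>e\<close>.\<close>
  have v_section: "?v \<cdot> tproj X G = idt X G"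
  proof (rule pullback_eqI[OF pb \<gamma> q cmp_in[OF v(1) pG] idt_in[OF G]])
    show "?v \<cdot> tproj X G \<cdot> p0 = idt X G \<cdot> p0"
      using cmp_assoc[OF v(1) pG p(1)] tproj_natural[OF p(1)] cmp_assoc[OF v(1) Tp0 pC] v(2)
        cmp_assoc[OF p(1) c1 pC] c1p cmp_idt[OF p(1)] idt_cmp[OF p(1)] by simp
    show "?v \<cdot> tproj X G \<cdot> p1 = idt X G \<cdot> p1"
      using cmp_assoc[OF v(1) pG p(2)] tproj_natural[OF p(2)] cmp_assoc[OF v(1) Tp1 pE] v(3)
        cmp_assoc[OF lift(1) H pE] Hp lift(2) idt_cmp[OF p(2)] by simp
  qed
  note s = pair_pullback[OF pb \<gamma> q c0 e0 e0q[symmetric]]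
  have sysG: "dynamical_system X \<^bold>1 G ?s ?v"
    using one_Obj G s(1) v(1) v_section
    by (simp add: dynamical_system_def vector_field_def)

  \<comment> \<open>Along a section \<open>\<langle>id, h\<rangle>\<close> of \<open>\<gamma>\<^sup>*(E)\<close>, the \<open>T \<pi>\<^sub>1\<close>-component of \<open>\<gamma>\<^sub>H\<close> is the lift at \<open>h\<close> of
    the velocity of \<open>\<gamma>\<close>.\<close>
  have field_along: "k \<cdot> (?L \<cdot> H) = pair X qf tf h (c1 \<cdot> Tar X \<gamma>) \<cdot> H"
    if k: "k \<in> Hom X C G" and k0: "k \<cdot> p0 = idt X C" and k1: "k \<cdot> p1 = h" for k h
    using cmp_assoc[OF k lift(1) H] cmp_pair_pullback[OF pbF q pM p(2) vel over k] k1
      cmp_assoc[OF p(1) c1 T\<gamma>] cmp_assoc[OF k p(1) c1\<gamma>] k0 idt_cmp[OF c1\<gamma>] by simp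

  have transport_iff: "c1 \<cdot> Tar X h \<cdot> R = h \<cdot> vzero X q i \<longleftrightarrow>
      c1 \<cdot> Tar X h = pair X qf tf h (c1 \<cdot> Tar X \<gamma>) \<cdot> H"
    if h: "h \<in> Hom X C E" and hq: "h \<cdot> q = \<gamma>" for h
  proof -
    have "c1 \<cdot> Tar X h \<cdot> tproj X E = h"
      using cmp_assoc[OF c1 Tar_in[OF h] pE] tproj_natural[OF h] cmp_assoc[OF c1 pC h] c1p
        idt_cmp[OF h] by simp
    moreover have "c1 \<cdot> Tar X h \<cdot> Tar X q = c1 \<cdot> Tar X \<gamma>"
      using cmp_assoc[OF c1 Tar_in[OF h] Tq] Tar_cmp[OF h q] hq by simp
    ultimately show ?thesis
      using vanishing_vertical_part_iff_horizontal[OF q vb hb conn cmp_in[OF c1 Tar_in[OF h]]]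
      by simp
  qed

  obtain k where k: "integral_curve X C c0 c1 G ?s ?v k"
    using solution_integral_curve[OF c0 c1 v(1)] assms(12) by blast
  have kH: "k \<in> Hom X C G" and kc0: "c0 \<cdot> k = ?s" and kc1: "c1 \<cdot> Tar X k = k \<cdot> ?v"
    using k by (auto simp: integral_curve_def)
  \<comment> \<open>\<open>\<gamma>\<^sub>H\<close> projects to the vector field \<open>c\<^sub>1\<close> on \<open>C\<close>, whose integral curve from \<open>c\<^sub>0\<close> is the identity.\<close>
  have "integral_curve X C c0 c1 C c0 c1 (k \<cdot> p0)"
    unfolding integral_curve_def
    using cmp_in[OF kH p(1)] cmp_assoc[OF c0 kH p(1)] kc0 s(2) Tar_cmp[OF kH p(1)]
      cmp_assoc[OF c1 Tar_in[OF kH] Tp0] kc1 cmp_assoc[OF kH v(1) Tp0] v(2)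
      cmp_assoc[OF kH p(1) c1] by simp
  moreover have "integral_curve X C c0 c1 C c0 c1 (idt X C)"
    unfolding integral_curve_def
    using idt_in[OF C] cmp_idt[OF c0] Tar_idt[OF C] cmp_idt[OF c1] idt_cmp[OF c1] by simp
  ultimately have k0: "k \<cdot> p0 = idt X C"
    by (rule integral_curve_unique[OF curve sysC])
  have h: "k \<cdot> p1 \<in> Hom X C E" using cmp_in[OF kH p(2)] .
  have hq: "k \<cdot> p1 \<cdot> q = \<gamma>"
    using cmp_assoc[OF kH p(2) q] p(3) cmp_assoc[OF kH p(1) \<gamma>] k0 idt_cmp[OF \<gamma>] by simp
  show ?thesis
  proof (rule ex1I[of _ "k \<cdot> p1"])
    have "c0 \<cdot> (k \<cdot> p1) = e0" using cmp_assoc[OF c0 kH p(2)] kc0 s(3) by simp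
    moreover have "c1 \<cdot> Tar X (k \<cdot> p1) = pair X qf tf (k \<cdot> p1) (c1 \<cdot> Tar X \<gamma>) \<cdot> H"
      using Tar_cmp[OF kH p(2)] cmp_assoc[OF c1 Tar_in[OF kH] Tp1] kc1
        cmp_assoc[OF kH v(1) Tp1] v(3) field_along[OF kH k0 refl] by simp
    ultimately show "k \<cdot> p1 \<in> Hom X C E \<and> c0 \<cdot> (k \<cdot> p1) = e0 \<and> k \<cdot> p1 \<cdot> q = \<gamma> \<and>
        c1 \<cdot> Tar X (k \<cdot> p1) \<cdot> R = k \<cdot> p1 \<cdot> vzero X q i"
      using h hq transport_iff[OF h hq] by simp
  next
    fix h' assume A: "h' \<in> Hom X C E \<and> c0 \<cdot> h' = e0 \<and> h' \<cdot> q = \<gamma> \<and>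
        c1 \<cdot> Tar X h' \<cdot> R = h' \<cdot> vzero X q i"
    then have h': "h' \<in> Hom X C E" and h'0: "c0 \<cdot> h' = e0" and h'q: "h' \<cdot> q = \<gamma>" by auto
    have h'1: "c1 \<cdot> Tar X h' = pair X qf tf h' (c1 \<cdot> Tar X \<gamma>) \<cdot> H"
      using A transport_iff[OF h' h'q] by simp
    have "idt X C \<cdot> \<gamma> = h' \<cdot> q" using idt_cmp[OF \<gamma>] h'q by simp
    then obtain k' where k': "k' \<in> Hom X C G" "k' \<cdot> p0 = idt X C" "k' \<cdot> p1 = h'"
      using pullback_factor[OF pb \<gamma> q idt_in[OF C] h'] by blast
    have "c0 \<cdot> k' = ?s"
      by (rule pullback_eqI[OF pb \<gamma> q cmp_in[OF c0 k'(1)] s(1)])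
        (simp_all add: cmp_assoc[OF c0 k'(1) p(1)] cmp_assoc[OF c0 k'(1) p(2)] k' s h'0
          cmp_idt[OF c0])
    moreover have "c1 \<cdot> Tar X k' = k' \<cdot> ?v"
    proof (rule pullback_eqI[OF Tpb T\<gamma> Tq cmp_in[OF c1 Tar_in[OF k'(1)]] cmp_in[OF k'(1) v(1)]])
      show "c1 \<cdot> Tar X k' \<cdot> Tar X p0 = k' \<cdot> ?v \<cdot> Tar X p0"
        using cmp_assoc[OF c1 Tar_in[OF k'(1)] Tp0] Tar_cmp[OF k'(1) p(1)] k'(2) Tar_idt[OF C]
          cmp_idt[OF c1] cmp_assoc[OF k'(1) v(1) Tp0] v(2) cmp_assoc[OF k'(1) p(1) c1]
          idt_cmp[OF c1] by simp
      show "c1 \<cdot> Tar X k' \<cdot> Tar X p1 = k' \<cdot> ?v \<cdot> Tar X p1"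
        using cmp_assoc[OF c1 Tar_in[OF k'(1)] Tp1] Tar_cmp[OF k'(1) p(2)] k'(3)
          cmp_assoc[OF k'(1) v(1) Tp1] v(3) h'1 field_along[OF k'] by simp
    qed
    ultimately have "integral_curve X C c0 c1 G ?s ?v k'"
      using k'(1) by (simp add: integral_curve_def)
    then have "k' = k" using integral_curve_unique[OF curve sysG _ k] by blast
    then show "h' = k \<cdot> p1" using k'(3) by simp
  qed
qed

end
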